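(* Let $q$ be a prime power, $n\ge1$, $G=\mathbb{F}_q$ and $H=\mathbb{F}_q^n$, and let $k\ge2$ be an integer. If $f:G\to H$ passes $\mathsf{Test\_NonZero}_k(f)$ with probability $\delta_k$, then \[\Bigl(1-\frac1q\Bigr)\delta_k^{\frac{1}{k-1}} \le \max_{\varphi}\mathrm{agr}(f,\varphi)\le \frac1q+\frac{q-1}{q}\,\delta_k^{\frac1k},\] where the maximum is over all $\mathbb{F}_q$-linear maps $\varphi:\mathbb{F}_q\to\mathbb{F}_q^n$.
   Context: $\mathrm{agr}(f,\varphi)=\Pr_{x\sim\mathbb{F}_q}[f(x)=\varphi(x)]$, $x$ uniform in $\mathbb{F}_q$. The $\mathbb{F}_q$-linear maps $\mathbb{F}_q\to\mathbb{F}_q^n$ are the maps $x\mapsto xv$ for $v\in\mathbb{F}_q^n$. $\mathsf{Test\_NonZero}_k(f)$: sample $(x_1,\dots,x_k)$ uniformly from $(\mathbb{F}_q\setminus\{0\})^k$; accept iff $x_i^{-1}f(x_i)=x_j^{-1}f(x_j)$ for all $i,j\in[k]$ (equivalently, iff there is an $\mathbb{F}_q$-linear $\varphi$ with $f(x_i)=\varphi(x_i)$ for all $i$). *)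

theory Defs
  imports "HOL-Probability.Probability"
begin

text \<open>The field with \<open>q\<close> elements is a type \<open>'a :: {field, finite}\<close>, so \<open>q = CARD('a)\<close>, and
  its \<open>n\<close>-th power is \<open>'a ^ 'n\<close> with \<open>n = CARD('n)\<close>.\<close>

definition agr :: "('a::finite \<Rightarrow> 'b) \<Rightarrow> ('a \<Rightarrow> 'b) \<Rightarrow> real" where
  "agr f \<phi> = measure_pmf.prob (pmf_of_set UNIV) {x. f x = \<phi> x}"

definition test_nonzero_accepts ::
  "nat \<Rightarrow> ('a::field \<Rightarrow> 'a ^ 'n) \<Rightarrow> (nat \<Rightarrow> 'a) \<Rightarrow> bool" where
  "test_nonzero_accepts k f x \<longleftrightarrow>
     (\<forall>i\<in>{1..k}. \<forall>j\<in>{1..k}. inverse (x i) *s f (x i) = inverse (x j) *s f (x j))"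

text \<open>The randomised test, as the distribution of its verdict. A tuple of length \<open>k\<close> is a
  function extensional on \<open>{1..k}\<close>, so that the sample space is finite.\<close>

definition test_nonzero :: "nat \<Rightarrow> ('a::{field,finite} \<Rightarrow> 'a ^ 'n) \<Rightarrow> bool pmf" where
  "test_nonzero k f =
     map_pmf (test_nonzero_accepts k f) (pmf_of_set ({1..k} \<rightarrow>\<^sub>E (UNIV - {0})))"

end

theory Submission
  imports Defs
begin

text \<open>For \<open>v \<in> \<F>\<^sub>q\<^sup>n\<close> let \<open>N\<^sub>v\<close> be the number of \<open>x \<noteq> 0\<close> with \<open>x\<inverse> f x = v\<close>. The \<open>N\<^sub>v\<close> sum up
  to \<open>q - 1\<close>, a tuple is accepted iff it lies in a single fibre, so
  \<open>\<delta> = \<Sum>\<^sub>v (N\<^sub>v / (q - 1))\<^sup>k\<close>, and the agreement of \<open>f\<close> with \<open>x \<mapsto> x v\<close> is \<open>N\<^sub>v / q\<close>, plus \<open>1 / q\<close> if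
  \<open>f 0 = 0\<close>. Hence \<open>\<delta>\<close> is at least each term \<open>(N\<^sub>v / (q - 1))\<^sup>k\<close> and at most
  \<open>(max N\<^sub>v / (q - 1))\<^sup>k\<^sup>-\<^sup>1\<close>.\<close>

text \<open>A linear map on the one-dimensional space \<open>'a\<close> is determined by its value
  at \<open>1\<close>. This turns the maximum over linear maps into one over the finite type of
  vectors.\<close>

lemma linear_scale_iff:
  "Vector_Spaces.linear (*) (*s) \<phi> \<longleftrightarrow> (\<exists>v. \<phi> = (\<lambda>x::'a::field. x *s (v :: 'a ^ 'n)))"
proof
  assume "Vector_Spaces.linear (*) (*s) \<phi>"
  then interpret Vector_Spaces.linear "(*)" "(*s)" \<phi> .
  have "\<phi> x = x *s \<phi> 1" for x
    using scale[of x 1] by simp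
  then show "\<exists>v. \<phi> = (\<lambda>x. x *s v)" by blast
next
  assume "\<exists>v. \<phi> = (\<lambda>x::'a. x *s v)"
  then obtain v where [simp]: "\<phi> = (\<lambda>x. x *s v)" ..
  show "Vector_Spaces.linear (*) (*s) \<phi>"
    by unfold_locales (simp_all add: algebra_simps)
qed

text \<open>Such tuples split disjointly by their common value \<open>v\<close>, and those with
  value \<open>v\<close> are the arbitrary tuples in the fibre over \<open>v\<close>. An empty
  \<open>I\<close> has no common value: its single tuple would be counted once for each
  \<open>v\<close>.\<close>

lemma card_constant_tuples:
  fixes g :: "'b \<Rightarrow> 'c"
  assumes "finite I" "I \<noteq> {}" "finite S"
  shows "card {x \<in> I \<rightarrow>\<^sub>E S. \<forall>i\<in>I. \<forall>j\<in>I. g (x i) = g (x j)}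
           = (\<Sum>v\<in>g ` S. card {s \<in> S. g s = v} ^ card I)"
proof -
  let ?F = "\<lambda>v. I \<rightarrow>\<^sub>E {s \<in> S. g s = v}"
  obtain i0 where i0: "i0 \<in> I" using assms by blast
  have "{x \<in> I \<rightarrow>\<^sub>E S. \<forall>i\<in>I. \<forall>j\<in>I. g (x i) = g (x j)} = (\<Union>v\<in>g ` S. ?F v)"
  proof (intro equalityI subsetI)
    fix x assume "x \<in> {x \<in> I \<rightarrow>\<^sub>E S. \<forall>i\<in>I. \<forall>j\<in>I. g (x i) = g (x j)}"
    then have x: "x \<in> I \<rightarrow>\<^sub>E S" and "\<And>i. i \<in> I \<Longrightarrow> g (x i) = g (x i0)"
      using i0 by blast+
    then have "x \<in> ?F (g (x i0))"
      by (simp add: PiE_iff)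
    moreover have "x i0 \<in> S"
      using x i0 by (rule PiE_mem)
    ultimately show "x \<in> (\<Union>v\<in>g ` S. ?F v)" by blast
  next
    fix x assume "x \<in> (\<Union>v\<in>g ` S. ?F v)"
    then obtain v where "x \<in> ?F v" by blast
    then show "x \<in> {x \<in> I \<rightarrow>\<^sub>E S. \<forall>i\<in>I. \<forall>j\<in>I. g (x i) = g (x j)}"
      by (simp add: PiE_iff)
  qed
  moreover have "card (\<Union>v\<in>g ` S. ?F v) = (\<Sum>v\<in>g ` S. card (?F v))"
  proof (rule card_UN_disjoint)
    show "\<forall>v\<in>g ` S. finite (?F v)"
      using assms by (auto intro!: finite_PiE)
    \<comment> \<open>A tuple in both sets would have \<open>g (x i0)\<close> equal to both
      \<open>v\<close> and \<open>w\<close>.\<close>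
    show "\<forall>v\<in>g ` S. \<forall>w\<in>g ` S. v \<noteq> w \<longrightarrow> ?F v \<inter> ?F w = {}"
      using i0 by (fastforce simp: PiE_iff)
  qed (use assms in simp)
  ultimately show ?thesis
    using assms by (simp add: card_PiE)
qed

lemma pmf_test_nonzero:
  fixes f :: "'a::{field,finite} \<Rightarrow> 'a ^ 'n"
  assumes "k > 0"
  shows "pmf (test_nonzero k f) True
           = (\<Sum>v\<in>UNIV. (real (card {x \<in> UNIV - {0}. inverse x *s f x = v}) / (real CARD('a) - 1)) ^ k)"
proof -
  let ?S = "UNIV - {0::'a}" and ?g = "\<lambda>x. inverse x *s f x"
  let ?X = "{1..k} \<rightarrow>\<^sub>E ?S"
  let ?N = "\<lambda>v. card {x \<in> ?S. ?g x = v}"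
  have cS: "real (card ?S) = real CARD('a) - 1"
    by (simp add: card_Diff_singleton)
  have "1 \<in> ?S" by simp
  then have ne: "?X \<noteq> {}" by (metis PiE_eq_empty_iff empty_iff)
  have fin: "finite ?X" by (auto intro: finite_PiE)
  have "pmf (test_nonzero k f) True = real (card (?X \<inter> {x. test_nonzero_accepts k f x})) / real (card ?X)"
    using ne fin by (simp add: test_nonzero_def pmf_map measure_pmf_of_set vimage_def)
  also have "?X \<inter> {x. test_nonzero_accepts k f x} = {x \<in> ?X. \<forall>i\<in>{1..k}. \<forall>j\<in>{1..k}. ?g (x i) = ?g (x j)}"
    by (auto simp: test_nonzero_accepts_def)
  also have "card \<dots> = (\<Sum>v\<in>?g ` ?S. ?N v ^ k)"
    using card_constant_tuples[of "{1..k}" ?S ?g] assms by simp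
  \<comment> \<open>Vectors outside the image have empty fibres and contribute \<open>0 ^ k\<close>,
    which vanishes because \<open>k > 0\<close>.\<close>
  also have "\<dots> = (\<Sum>v\<in>UNIV. ?N v ^ k)"
  proof (rule sum.mono_neutral_left)
    show "\<forall>v\<in>UNIV - ?g ` ?S. ?N v ^ k = 0"
      using assms by (auto simp: card_eq_0_iff)
  qed simp_all
  also have "card ?X = card ?S ^ k" by (simp add: card_PiE)
  finally show ?thesis
    by (simp only: of_nat_sum of_nat_power cS sum_divide_distrib power_divide)
qed

text \<open>The point \<open>0\<close> is treated apart: every linear map vanishes there, so its
  contribution does not depend on \<open>v\<close>.\<close>

lemma agr_scale_eq:
  fixes f :: "'a::{field,finite} \<Rightarrow> 'a ^ 'n"
  shows "agr f (\<lambda>x. x *s v)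
    = (real (card {x \<in> UNIV - {0}. inverse x *s f x = v}) + of_bool (f 0 = 0)) / real CARD('a)"
proof -
  let ?A = "{x \<in> UNIV - {0}. inverse x *s f x = v}"
  have *: "inverse x *s f x = v \<longleftrightarrow> f x = x *s v" if "x \<noteq> 0" for x
    using that by (auto simp: vector_smult_assoc)
  have "x \<in> {x. f x = x *s v} \<longleftrightarrow> x \<in> ?A \<union> (if f 0 = 0 then {0} else {})" for x
    using *[of x] by (cases "x = 0") simp_all
  then have "{x. f x = x *s v} = ?A \<union> (if f 0 = 0 then {0} else {})" by blast
  then have "card {x. f x = x *s v} = card ?A + of_bool (f 0 = 0)"
    by (simp add: card_Un_disjoint)
  then show ?thesis
    by (simp add: agr_def measure_pmf_of_set)
qed

lemma sum_card_fibres: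
  fixes g :: "'a::finite \<Rightarrow> 'b::finite"
  shows "(\<Sum>v\<in>UNIV. card {x \<in> S. g x = v}) = card S"
  using sum.group[of S UNIV g "\<lambda>_. 1::nat"] by simp

text \<open>Bounding all but one factor of each power by \<open>M\<close> leaves the sum of the
  \<open>p v\<close>, which is 1.\<close>

lemma sum_power_le_max_power:
  fixes p :: "'b \<Rightarrow> real"
  assumes "\<And>v. v \<in> V \<Longrightarrow> 0 \<le> p v" "\<And>v. v \<in> V \<Longrightarrow> p v \<le> M" "sum p V = 1"
  shows "(\<Sum>v\<in>V. p v ^ Suc m) \<le> M ^ m"
proof -
  have "(\<Sum>v\<in>V. p v ^ Suc m) \<le> (\<Sum>v\<in>V. p v * M ^ m)"
    using assms by (intro sum_mono) (auto intro!: mult_left_mono power_mono)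
  also have "\<dots> = M ^ m"
    using assms by (simp flip: sum_distrib_right)
  finally show ?thesis .
qed

text \<open>The real power agrees with the monotone function \<open>root m\<close> even at
  \<open>x = 0\<close>, so the case of acceptance probability zero is included.\<close>

lemma powr_inverse_le_iff:
  fixes x y :: real
  assumes "0 \<le> x" "0 \<le> y" "m > 0"
  shows "x powr (1 / real m) \<le> y \<longleftrightarrow> x \<le> y ^ m"
    and "y \<le> x powr (1 / real m) \<longleftrightarrow> y ^ m \<le> x"
proof -
  have "x powr (1 / real m) = root m x"
    using assms by (simp add: root_powr_inverse)
  moreover have "y = root m (y ^ m)"
    using assms by (simp add: real_root_power_cancel)
  ultimately show "x powr (1 / real m) \<le> y \<longleftrightarrow> x \<le> y ^ m"
    and "y \<le> x powr (1 / real m) \<longleftrightarrow> y ^ m \<le> x"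
    using assms by (metis real_root_le_iff)+
qed

theorem theorem4p11:
  fixes f :: "'a::{field,finite} \<Rightarrow> 'a ^ 'n" and k :: nat and \<delta> :: real
  assumes "k \<ge> 2"
    and "\<delta> = pmf (test_nonzero k f) True"
  shows "(1 - 1 / real CARD('a)) * \<delta> powr (1 / (real k - 1))
           \<le> Max {agr f \<phi> |\<phi>. Vector_Spaces.linear (*) (*s) \<phi>}
         \<and> Max {agr f \<phi> |\<phi>. Vector_Spaces.linear (*) (*s) \<phi>}
           \<le> 1 / real CARD('a) + (real CARD('a) - 1) / real CARD('a) * \<delta> powr (1 / real k)"
proof -
  define q where "q = real CARD('a)"
  define N where "N v = real (card {x \<in> UNIV - {0::'a}. inverse x *s f x = v})" for v
  \<comment> \<open>This is the distribution of \<open>inverse x *s f x\<close> for uniform nonzero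
    \<open>x\<close>.\<close>
  define p where "p v = N v / (q - 1)" for v
  have "{agr f \<phi> |\<phi>. Vector_Spaces.linear (*) (*s) \<phi>} = range (\<lambda>v. agr f (\<lambda>x. x *s v))"
    by (auto simp: linear_scale_iff)
  then obtain A where A: "A = Max {agr f \<phi> |\<phi>. Vector_Spaces.linear (*) (*s) \<phi>}"
    "A = Max (range (\<lambda>v. agr f (\<lambda>x. x *s v)))" by simp
  have "card {0, 1::'a} \<le> CARD('a)" by (rule card_mono) auto
  then have q: "q > 1" by (simp add: q_def)
  have p_nonneg: "0 \<le> p v" for v
    using q by (simp add: p_def N_def)
  have agr: "agr f (\<lambda>x. x *s v) = (q - 1) / q * p v + of_bool (f 0 = 0) / q" for v
    using q agr_scale_eq[of f v] by (simp add: p_def N_def q_def add_divide_distrib)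
  have "sum N UNIV = real (card (UNIV - {0::'a}))"
    unfolding N_def by (simp only: sum_card_fibres flip: of_nat_sum)
  then have "sum p UNIV = 1"
    using q by (simp add: p_def q_def card_Diff_singleton flip: sum_divide_distrib)
  have \<delta>: "\<delta> = (\<Sum>v\<in>UNIV. p v ^ k)"
    using assms by (simp add: pmf_test_nonzero p_def N_def q_def)
  then have \<delta>_nonneg: "\<delta> \<ge> 0"
    using p_nonneg by (simp add: sum_nonneg)
  obtain w where w: "Max (range p) = p w"
    using Max_in[of "range p"] by (metis finite finite_imageI imageE UNIV_not_empty image_is_empty)
  have "p v \<le> p w" for v
    using w by (metis Max_ge finite finite_imageI rangeI)
  \<comment> \<open>The exponent \<open>k\<close> is written as a successor;
    \<open>k \<ge> 2\<close> makes \<open>k - 1\<close> positive, so that a root can be taken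
    next.\<close>
  then have "(\<Sum>v\<in>UNIV. p v ^ Suc (k - 1)) \<le> p w ^ (k - 1)"
    using p_nonneg \<open>sum p UNIV = 1\<close> by (intro sum_power_le_max_power) auto
  then have "\<delta> powr (1 / real (k - 1)) \<le> p w"
    using assms \<delta> \<delta>_nonneg p_nonneg by (subst powr_inverse_le_iff) auto
  then have "\<delta> powr (1 / (real k - 1)) \<le> p w"
    using assms by (simp add: of_nat_diff)
  then have "(1 - 1 / q) * \<delta> powr (1 / (real k - 1)) \<le> (1 - 1 / q) * p w"
    using q by (intro mult_left_mono) auto
  \<comment> \<open>The possible agreement at \<open>0\<close> is dropped here; the upper bound
    instead allows for it in full, as \<open>1 / q\<close>.\<close>
  also have "\<dots> \<le> agr f (\<lambda>x. x *s w)"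
    using q by (simp add: agr diff_divide_distrib)
  also have "\<dots> \<le> A"
    unfolding A(2) by (rule Max_ge) auto
  finally have lower: "(1 - 1 / q) * \<delta> powr (1 / (real k - 1)) \<le> A" .
  have "agr f (\<lambda>x. x *s v) \<le> 1 / q + (q - 1) / q * \<delta> powr (1 / real k)" for v
  proof -
    have "p v ^ k \<le> \<delta>"
      unfolding \<delta> using p_nonneg by (intro member_le_sum) auto
    then have "p v \<le> \<delta> powr (1 / real k)"
      using assms \<delta>_nonneg p_nonneg by (subst powr_inverse_le_iff) auto
    then have "(q - 1) / q * p v \<le> (q - 1) / q * \<delta> powr (1 / real k)"
      using q by (intro mult_left_mono) auto
    moreover have "of_bool (f 0 = 0) / q \<le> 1 / q"
      using q by (simp add: divide_right_mono)
    ultimately show ?thesis unfolding agr by linarith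
  qed
  then have "A \<le> 1 / q + (q - 1) / q * \<delta> powr (1 / real k)"
    unfolding A(2) by (intro Max.boundedI) auto
  with lower show ?thesis
    unfolding A(1) q_def by blast
qed

end
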